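(* Let $\{r_k\}_{k\ge1}$, $\{\eta_k\}_{k\ge1}$, $\{z_k\}_{k\ge1}$, $\{\rho_k\}_{k\ge0}$ be positive stochastic sequences adapted to a filtration $\{\mathcal F_k\}$. Let $\theta_k\in(0,1)$ be a bounded sequence, let $a_k$ be a positive decreasing sequence, let $h>0$, $p_k\ge0$, and let $\beta_k,\bar\beta_k\ge0$ with $\sum_{k=1}^\infty\beta_k<+\infty$ and $\sum_{k=1}^\infty\bar\beta_k<+\infty$. Suppose that $$\mathbb E[r_{k+2}\mid\mathcal F_{k+1}]\le(1+\theta_k)r_{k+1}-\theta_kr_k-\eta_k+\beta_k+hp_kz_{k+1},\qquad k\ge1,$$ $$\mathbb E[z_{k+2}\mid\mathcal F_{k+1}]\le(1-p_k)z_{k+1}-a_k(\rho_k-\rho_{k-1})+\bar\beta_k,\qquad k\ge1.$$ Then $r_k$ converges almost surely to some finite random variable $r_\infty$, and $\sum_{k=1}^\infty\eta_k<+\infty$ almost surely.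
   Context: All random variables are real-valued and live on a common probability space; $\{\theta_k\}$, $\{a_k\}$, $\{p_k\}$, $\{\beta_k\}$, $\{\bar\beta_k\}$ are deterministic sequences and $h$ is a constant; inequalities between random variables hold almost surely.
   Formalization: "θ_k∈(0,1) bounded" is taken to mean bounded away from 1 (θ_k ≤ c < 1 for all k); with merely θ_k∈(0,1) the claim fails, e.g. for θ_k = 1 − 1/(k+1)², where r_k can tend to infinity. *)

theory Defs
  imports "HOL-Probability.Probability"
begin

text \<open>
  The conditional expectation of a nonnegative real random variable that is not assumed to be
  integrable takes values in the extended half line. The library's
  \<^const>\<open>real_cond_exp\<close> maps the value infinity to 0, so \<^const>\<open>nn_cond_exp\<close>
  is used instead. It is embedded into \<^typ>\<open>ereal\<close>, so that it can be compared
  with a real number of arbitrary sign without truncating that number at 0.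
\<close>

definition pos_cond_exp :: "'a measure \<Rightarrow> 'a measure \<Rightarrow> ('a \<Rightarrow> real) \<Rightarrow> 'a \<Rightarrow> ereal" where
  "pos_cond_exp M G X = (\<lambda>\<omega>. enn2ereal (nn_cond_exp M G (\<lambda>\<omega>'. ennreal (X \<omega>')) \<omega>))"

lemma pos_cond_exp_eq_real_cond_exp:
  assumes "prob_space M" "subalgebra M G" "integrable M X" "AE \<omega> in M. 0 \<le> X \<omega>"
  shows "AE \<omega> in M. pos_cond_exp M G X \<omega> = ereal (real_cond_exp M G X \<omega>)"
proof -
  interpret prob_space M by fact
  interpret finite_measure_subalgebra M G
    by unfold_locales (rule assms(2))
  have [measurable]: "X \<in> borel_measurable M"
    using assms(3) by simp
  let ?N = "nn_cond_exp M G (\<lambda>\<omega>. ennreal (X \<omega>))"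
  have "(\<integral>\<^sup>+\<omega>. ?N \<omega> \<partial>M) = (\<integral>\<^sup>+\<omega>. ennreal (X \<omega>) \<partial>M)"
    using nn_cond_exp_intg[of "\<lambda>_. 1" "\<lambda>\<omega>. ennreal (X \<omega>)"] by simp
  also have "\<dots> \<noteq> \<infinity>"
    using assms(3,4) by (simp add: nn_integral_eq_integral)
  finally have fin: "AE \<omega> in M. ?N \<omega> \<noteq> \<infinity>"
    by (intro nn_integral_PInf_AE) auto
  have real: "enn2ereal y = ereal (enn2real y)" if "y \<noteq> \<infinity>" for y :: ennreal
    using that by (cases y) simp_all
  have "AE \<omega> in M. nn_cond_exp M G (\<lambda>\<omega>. ennreal (- X \<omega>)) \<omega> = nn_cond_exp M G (\<lambda>\<omega>. 0) \<omega>"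
    using assms(4) by (intro nn_cond_exp_cong) (auto elim!: eventually_mono simp: ennreal_neg)
  moreover have "AE \<omega> in M. nn_cond_exp M G (\<lambda>\<omega>. 0) \<omega> = 0"
    using nn_cond_exp_F_meas[of "\<lambda>_. 0"] by (auto elim!: eventually_mono)
  ultimately show ?thesis
    using fin by eventually_elim (simp add: pos_cond_exp_def real_cond_exp_def real)
qed

end

theory Submission
  imports Defs
begin

text \<open>
  The quantities in the hypotheses need not be integrable, so one works on the event that
  \<open>r 1\<close>, \<open>r 2\<close>, \<open>z 2\<close> and \<open>\<rho> 0\<close> are at most \<open>N\<close>; the two recursions propagate integrability from
  there, and these events exhaust the space. As \<open>a\<close> decreases, \<open>z (k + 1) + a k * \<rho> (k - 1)\<close>
  decreases in expectation by at least \<open>p k\<close> times the expectation of \<open>z (k + 1)\<close>, up to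
  \<open>\<beta>bar k\<close>; hence the errors \<open>\<beta> k + h * p k * z (k + 1)\<close> have summable expectations. Choose bounded
  weights \<open>c\<close> with \<open>c k = \<theta> k * (1 + c (k + 1))\<close>. Then \<open>(1 + c k) * r (k + 1) - c k * r k\<close> is an
  almost supermartingale with decrement at least \<open>\<eta> k\<close>, bounded in the L1 norm. So it converges by
  Doob's upcrossing argument and \<open>\<eta>\<close> is summable, and \<open>r (k + 1)\<close>, being a convex combination of
  this convergent sequence and \<open>r k\<close> with weights bounded away from 0 on the former, converges
  as well.
\<close>

section \<open>Upcrossings of a real sequence\<close>

text \<open>The trading strategy of Doob's upcrossing argument: buy below \<open>a\<close>, sell at or above \<open>b\<close>.\<close>

primrec holding :: "real \<Rightarrow> real \<Rightarrow> (nat \<Rightarrow> real) \<Rightarrow> nat \<Rightarrow> bool" where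
  "holding a b w 0 \<longleftrightarrow> w 0 < a"
| "holding a b w (Suc n) \<longleftrightarrow> (if holding a b w n then w (Suc n) < b else w (Suc n) < a)"

primrec upcrossings :: "real \<Rightarrow> real \<Rightarrow> (nat \<Rightarrow> real) \<Rightarrow> nat \<Rightarrow> nat" where
  "upcrossings a b w 0 = 0"
| "upcrossings a b w (Suc n) =
     upcrossings a b w n + (if holding a b w n \<and> b \<le> w (Suc n) then 1 else 0)"

text \<open>Buying below \<open>a\<close> and selling at or above \<open>b\<close> earns at least
  \<open>b - a\<close> per completed round. The induction closes because the invariant also carries
  the open position, valued from \<open>a\<close> since it was bought below
  \<open>a\<close>.\<close>

lemma upcrossings_gain:
  assumes "a < b"
  shows "(b - a) * real (upcrossings a b w n) + (if holding a b w n then w n - a else 0)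
    \<le> (\<Sum>i<n. if holding a b w i then w (Suc i) - w i else 0)"
  by (induction n) (use assms in \<open>auto simp: algebra_simps\<close>)

lemma mono_upcrossings: "mono (upcrossings a b w)"
  by (rule monoI, rule lift_Suc_mono_le) auto

lemma holding_persists:
  assumes "holding a b w m" "m \<le> n" "\<And>k. m < k \<Longrightarrow> k \<le> n \<Longrightarrow> w k < b"
  shows "holding a b w n"
  using assms(2,1,3) by (induction n rule: dec_induct) auto

text \<open>A later value below \<open>a\<close> forces a held position, whether newly bought or
  already open. The first subsequent value at or above \<open>b\<close> then completes one more
  round, because nothing in between triggers a sale.\<close>

lemma upcrossings_unbounded:
  assumes "a < b" "\<exists>\<^sub>F n in sequentially. w n < a" "\<exists>\<^sub>F n in sequentially. b \<le> w n"
  shows "\<exists>n. k \<le> upcrossings a b w n"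
proof (induction k)
  case 0
  show ?case by simp
next
  case (Suc k)
  then obtain n where n: "k \<le> upcrossings a b w n" by blast
  obtain m where m: "m > n" "w m < a"
    using assms(2) by (auto simp: frequently_sequentially) (metis Suc_le_eq)
  have hm: "holding a b w m"
    using m assms(1) by (cases m) auto
  define l where "l = (LEAST l. m < l \<and> b \<le> w l)"
  have ex: "\<exists>l. m < l \<and> b \<le> w l"
    using assms(3) by (auto simp: frequently_sequentially) (metis Suc_le_eq)
  have l: "m < l" "b \<le> w l"
    using LeastI_ex[OF ex] by (auto simp: l_def)
  have below: "w j < b" if "m < j" "j < l" for j
    using not_less_Least[of j "\<lambda>l. m < l \<and> b \<le> w l"] that by (auto simp: l_def)
  obtain l' where l': "l = Suc l'" using l by (cases l) auto
  have "holding a b w l'"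
    using holding_persists[OF hm, of l'] below l l' by auto
  then have "upcrossings a b w l = Suc (upcrossings a b w l')"
    using l l' by simp
  moreover have "upcrossings a b w n \<le> upcrossings a b w l'"
    by (rule monoD[OF mono_upcrossings]) (use l l' m in auto)
  ultimately show ?case using n by (intro exI[of _ l]) auto
qed

text \<open>A gap between liminf and limsup contains two rationals, so only countably many intervals
  have to be excluded later. Without a gap the extended limit exists, and a bound along infinitely
  many indices already keeps it finite.\<close>

lemma convergent_if_no_crossings:
  fixes w :: "nat \<Rightarrow> real"
  assumes "\<And>a b. a \<in> \<rat> \<Longrightarrow> b \<in> \<rat> \<Longrightarrow> a < b \<Longrightarrow>
      \<not> ((\<exists>\<^sub>F n in sequentially. w n < a) \<and> (\<exists>\<^sub>F n in sequentially. b \<le> w n))"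
    and "\<exists>\<^sub>F n in sequentially. \<bar>w n\<bar> \<le> C"
  shows "convergent w"
proof -
  let ?w = "\<lambda>n. ereal (w n)"
  have eq: "liminf ?w = limsup ?w"
  proof (rule ccontr)
    assume "liminf ?w \<noteq> limsup ?w"
    then have "liminf ?w < limsup ?w"
      using Liminf_le_Limsup[of sequentially ?w] by (simp add: order.strict_iff_order)
    then obtain a' where a': "liminf ?w < ereal a'" "ereal a' < limsup ?w"
      using ereal_dense2 by blast
    then obtain b' where b': "ereal a' < ereal b'" "ereal b' < limsup ?w"
      using ereal_dense2 by blast
    obtain a where a: "a \<in> \<rat>" "a' < a" "a < b'" using b' Rats_dense_in_real[of a' b'] by auto
    obtain b where b: "b \<in> \<rat>" "a < b" "b < b'" using a Rats_dense_in_real[of a b'] by auto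
    have "\<exists>\<^sub>F n in sequentially. ?w n < ereal a"
    proof (rule ccontr)
      assume "\<not> (\<exists>\<^sub>F n in sequentially. ?w n < ereal a)"
      then have "\<forall>\<^sub>F n in sequentially. ereal a \<le> ?w n"
        by (simp add: frequently_def not_less)
      then have "ereal a \<le> liminf ?w" by (rule Liminf_bounded)
      then show False using a' a by (meson ereal_less_eq(3) leD less_le_trans order.strict_implies_order)
    qed
    moreover have "\<exists>\<^sub>F n in sequentially. ereal b \<le> ?w n"
    proof (rule ccontr)
      assume "\<not> (\<exists>\<^sub>F n in sequentially. ereal b \<le> ?w n)"
      then have "\<forall>\<^sub>F n in sequentially. ?w n \<le> ereal b"
        by (auto simp: frequently_def not_le elim: eventually_mono)
      then have "limsup ?w \<le> ereal b" by (rule Limsup_bounded)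
      then show False using b' b by (meson ereal_less_eq(3) leD le_less_trans order.strict_implies_order)
    qed
    ultimately show False using assms(1)[OF a(1) b(1,2)] by simp
  qed
  define l where "l = limsup ?w"
  have lim: "?w \<longlonglongrightarrow> l"
    unfolding l_def by (rule Liminf_eq_Limsup) (use eq in auto)
  have "\<bar>l\<bar> \<noteq> \<infinity>"
  proof
    assume l: "\<bar>l\<bar> = \<infinity>"
    have "(\<lambda>n. \<bar>?w n\<bar>) \<longlonglongrightarrow> \<bar>l\<bar>"
      by (intro tendsto_abs_ereal lim)
    then have "\<forall>\<^sub>F n in sequentially. ereal C < \<bar>?w n\<bar>"
      using l by (simp only: tendsto_PInfty)
    then have "\<forall>\<^sub>F n in sequentially. \<not> \<bar>w n\<bar> \<le> C"
      by (simp add: not_le)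
    then show False using assms(2) by (simp add: frequently_def)
  qed
  then obtain l' where "l = ereal l'" by auto
  then show ?thesis using lim by (auto simp: convergent_def)
qed

section \<open>Almost sure convergence of L1-bounded almost supermartingales\<close>

text \<open>By Fatou's lemma the liminf of the absolute values has finite integral, so it is finite
  almost everywhere. This bounds infinitely many terms only, which is enough for monotone sequences
  and for excluding infinite limits.\<close>

lemma AE_frequently_bounded:
  fixes f :: "nat \<Rightarrow> 'a \<Rightarrow> real"
  assumes "\<And>n. integrable M (f n)" "\<And>n. (\<integral>x. \<bar>f n x\<bar> \<partial>M) \<le> K"
  shows "AE x in M. \<exists>C. \<exists>\<^sub>F n in sequentially. \<bar>f n x\<bar> \<le> C"
proof -
  have [measurable]: "\<And>n. f n \<in> borel_measurable M" using assms(1) by auto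
  have "(\<integral>\<^sup>+x. liminf (\<lambda>n. ennreal \<bar>f n x\<bar>) \<partial>M) \<le> liminf (\<lambda>n. \<integral>\<^sup>+x. ennreal \<bar>f n x\<bar> \<partial>M)"
    by (rule nn_integral_liminf) measurable
  also have "(\<lambda>n. \<integral>\<^sup>+x. ennreal \<bar>f n x\<bar> \<partial>M) = (\<lambda>n. ennreal (\<integral>x. \<bar>f n x\<bar> \<partial>M))"
    using assms(1) by (intro ext nn_integral_eq_integral) auto
  also have "liminf (\<lambda>n. ennreal (\<integral>x. \<bar>f n x\<bar> \<partial>M)) \<le> liminf (\<lambda>n::nat. ennreal K)"
    by (intro Liminf_mono always_eventually allI ennreal_leI assms(2))
  also have "\<dots> < \<infinity>" by (simp add: Liminf_const)
  finally have "AE x in M. liminf (\<lambda>n. ennreal \<bar>f n x\<bar>) \<noteq> \<infinity>"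
    by (intro nn_integral_PInf_AE) (auto simp: less_top)
  then show ?thesis
  proof eventually_elim
    case (elim x)
    then obtain l where l: "liminf (\<lambda>n. ennreal \<bar>f n x\<bar>) = ennreal l" "0 \<le> l"
      by (cases "liminf (\<lambda>n. ennreal \<bar>f n x\<bar>)") auto
    define C where "C = l + 1"
    have C: "liminf (\<lambda>n. ennreal \<bar>f n x\<bar>) < ennreal C" "0 \<le> C"
      using l by (simp_all add: C_def ennreal_less_iff)
    show ?case
    proof (rule exI[of _ C], rule ccontr)
      assume "\<not> (\<exists>\<^sub>F n in sequentially. \<bar>f n x\<bar> \<le> C)"
      then have "\<forall>\<^sub>F n in sequentially. ennreal C \<le> ennreal \<bar>f n x\<bar>"
        using C(2) by (auto simp: frequently_def not_le elim!: eventually_mono intro!: ennreal_leI)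
      then have "ennreal C \<le> liminf (\<lambda>n. ennreal \<bar>f n x\<bar>)" by (rule Liminf_bounded)
      then show False using C by simp
    qed
  qed
qed

lemma incseq_frequently_bounded:
  fixes u :: "nat \<Rightarrow> real"
  assumes "incseq u" "\<exists>\<^sub>F n in sequentially. u n \<le> C"
  shows "u n \<le> C"
proof -
  obtain m where "m \<ge> n" "u m \<le> C"
    using assms(2) by (auto simp: frequently_sequentially)
  then show ?thesis using incseqD[OF assms(1), of n m] by simp
qed

text \<open>Doob's argument: by the defect bound the gain of the strategy has bounded expectation, so the
  expected number of upcrossings of every interval is bounded.\<close>

lemma almost_supermartingale_convergent:
  fixes W :: "nat \<Rightarrow> 'a \<Rightarrow> real" and e :: "nat \<Rightarrow> real"
  assumes "prob_space M" "filtration (space M) G" "\<And>n. subalgebra M (G n)"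
    and meas: "\<And>n. W n \<in> borel_measurable (G n)"
    and int: "\<And>n. integrable M (W n)"
    and step: "\<And>n B. B \<in> sets (G n) \<Longrightarrow>
      (\<integral>x. indicator B x * (W (Suc n) x - W n x) \<partial>M) \<le> e n"
    and e: "\<And>n. 0 \<le> e n" "summable e"
    and bdd: "\<And>n. (\<integral>x. \<bar>W n x\<bar> \<partial>M) \<le> K"
  shows "AE x in M. convergent (\<lambda>n. W n x)"
proof -
  interpret prob_space M by fact
  have space: "space (G n) = space M" for n
    by (rule filtration.space_F[OF assms(2)])
  have mono: "sets (G m) \<subseteq> sets (G n)" if "m \<le> n" for m n
    by (rule filtration.sets_F_mono[OF assms(2) that])
  have sub: "sets (G n) \<subseteq> sets M" for n
    using assms(3)[of n] by (simp add: subalgebra_def)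
  have meas_le: "W m \<in> borel_measurable (G n)" if "m \<le> n" for m n
    by (rule measurable_from_subalg[OF _ meas]) (use space mono that in \<open>auto simp: subalgebra_def\<close>)
  have measM [measurable]: "W n \<in> borel_measurable M" for n
    using int by auto
  \<comment> \<open>Whether the position is held at time \<open>k\<close> is decided by
    \<open>W 0\<close>, ..., \<open>W k\<close>. Allowing any later sigma-algebra \<open>G n\<close>
    keeps the whole induction inside one family of sets.\<close>
  have hold: "{x \<in> space M. holding a b (\<lambda>n. W n x) k} \<in> sets (G n)" if "k \<le> n" for a b k n
    using that
  proof (induction k)
    case 0
    note [measurable] = meas_le[of 0 n]
    have "{x \<in> space (G n). W 0 x < a} \<in> sets (G n)" by measurable
    then show ?case by (simp add: space)
  next
    case (Suc k)
    note [measurable] = meas_le[OF Suc.prems]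
    have IH: "{x \<in> space M. holding a b (\<lambda>n. W n x) k} \<in> sets (G n)" using Suc by simp
    have 1: "{x \<in> space M. W (Suc k) x < c} \<in> sets (G n)" for c
    proof -
      have "{x \<in> space (G n). W (Suc k) x < c} \<in> sets (G n)" by measurable
      then show ?thesis by (simp add: space)
    qed
    have "{x \<in> space M. holding a b (\<lambda>n. W n x) (Suc k)} =
        ({x \<in> space M. holding a b (\<lambda>n. W n x) k} \<inter> {x \<in> space M. W (Suc k) x < b}) \<union>
        ({x \<in> space M. W (Suc k) x < a} - {x \<in> space M. holding a b (\<lambda>n. W n x) k})"
      by auto
    also have "\<dots> \<in> sets (G n)" using IH 1 by blast
    finally show ?case .
  qed
  have cross: "AE x in M. \<not> ((\<exists>\<^sub>F n in sequentially. W n x < a) \<and> (\<exists>\<^sub>F n in sequentially. b \<le> W n x))"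
    if ab: "a < b" for a b
  proof -
    define H where "H = (\<lambda>n. {x \<in> space M. holding a b (\<lambda>n. W n x) n})"
    define U where "U = (\<lambda>n x. real (upcrossings a b (\<lambda>n. W n x) n))"
    have H [measurable]: "H n \<in> sets M" for n using hold[of n n a b] sub by (auto simp: H_def)
    have USuc: "U (Suc n) x = U n x + indicator (H n \<inter> {x \<in> space M. b \<le> W (Suc n) x}) x"
      if "x \<in> space M" for n x
      using that by (auto simp: U_def H_def indicator_def)
    have Umeas [measurable]: "U n \<in> borel_measurable M" for n
    proof (induction n)
      case 0
      show ?case by (simp add: U_def)
    next
      case (Suc n)
      note [measurable] = Suc
      have "(\<lambda>x. U n x + indicator (H n \<inter> {x \<in> space M. b \<le> W (Suc n) x}) x) \<in> borel_measurable M"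
        by measurable
      then show ?case by (rule measurable_cong[THEN iffD1, rotated]) (simp add: USuc)
    qed
    have Ubd: "U n x \<le> real n" for n x
    proof -
      have "upcrossings a b w n \<le> n" for w by (induction n) auto
      then show ?thesis by (simp add: U_def)
    qed
    have Uint: "integrable M (U n)" for n
      by (rule integrable_const_bound[OF _ Umeas, of _ "real n"]) (use Ubd in \<open>simp add: U_def\<close>)
    define D where "D = (\<lambda>i x. indicator (H i) x * (W (Suc i) x - W i x))"
    \<comment> \<open>A position open at time \<open>n\<close> is valued at
      \<open>W n x - a\<close>, which is at least
      \<open>- \<bar>W n x\<bar> - \<bar>a\<bar>\<close>.\<close>
    have gain: "(b - a) * U n x \<le> (\<Sum>i<n. D i x) + \<bar>W n x\<bar> + \<bar>a\<bar>"
      if x: "x \<in> space M" for n x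
    proof -
      have "(\<Sum>i<n. D i x) =
          (\<Sum>i<n. if holding a b (\<lambda>n. W n x) i then W (Suc i) x - W i x else 0)"
        by (rule sum.cong) (use x in \<open>auto simp: D_def H_def\<close>)
      then show ?thesis
        using upcrossings_gain[OF ab, of "\<lambda>n. W n x" n] by (auto simp: U_def split: if_splits)
    qed
    have intH: "integrable M (D i)" for i
      unfolding D_def
      using integrable_mult_indicator[OF H, of "\<lambda>x. W (Suc i) x - W i x"] int by simp
    \<comment> \<open>The event \<open>H i\<close> lies in \<open>G i\<close>, so
      \<open>step\<close> bounds each expected increment by \<open>e i\<close>; summability of
      \<open>e\<close> makes the resulting bound independent of \<open>n\<close>.\<close>
    have "(b - a) * (\<integral>x. U n x \<partial>M) \<le> suminf e + K + \<bar>a\<bar>" for n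
    proof -
      have "(b - a) * (\<integral>x. U n x \<partial>M) = (\<integral>x. (b - a) * U n x \<partial>M)" by simp
      also have "\<dots> \<le> (\<integral>x. (\<Sum>i<n. D i x) + \<bar>W n x\<bar> + \<bar>a\<bar> \<partial>M)"
        by (intro integral_mono Bochner_Integration.integrable_add Bochner_Integration.integrable_sum
            integrable_mult_right integrable_abs integrable_const Uint intH int gain)
      also have "\<dots> = (\<Sum>i<n. \<integral>x. D i x \<partial>M) + (\<integral>x. \<bar>W n x\<bar> \<partial>M) + \<bar>a\<bar>"
        using intH int by (simp add: prob_space)
      also have "\<dots> \<le> (\<Sum>i<n. e i) + K + \<bar>a\<bar>"
        by (intro add_mono sum_mono bdd) (auto simp: D_def H_def intro!: step hold)
      also have "\<dots> \<le> suminf e + K + \<bar>a\<bar>"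
        using sum_le_suminf[of e "{..<n}"] e by auto
      finally show ?thesis .
    qed
    then have "(\<integral>x. \<bar>U n x\<bar> \<partial>M) \<le> (suminf e + K + \<bar>a\<bar>) / (b - a)" for n
      using ab by (simp add: U_def pos_le_divide_eq mult.commute)
    from AE_frequently_bounded[of M U, OF Uint this] show ?thesis
    proof eventually_elim
      case (elim x)
      then obtain C where C: "\<exists>\<^sub>F n in sequentially. \<bar>U n x\<bar> \<le> C" by blast
      \<comment> \<open>Since the counts increase, a bound along infinitely many \<open>n\<close>
        bounds all of them, which contradicts infinitely many crossings.\<close>
      have "incseq (\<lambda>n. U n x)"
        using mono_upcrossings[of a b "\<lambda>n. W n x"] by (auto simp: U_def mono_def)
      then have bound: "U n x \<le> C" for n
        by (rule incseq_frequently_bounded) (use C in \<open>auto elim!: frequently_elim1\<close>)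
      obtain k where "C < real k" using reals_Archimedean2 by blast
      with bound show ?case
        using upcrossings_unbounded[OF ab, of "\<lambda>n. W n x" k]
        by (auto simp: U_def) (meson of_nat_le_iff not_le order.trans)
    qed
  qed
  have "AE x in M. \<forall>a\<in>\<rat>. \<forall>b\<in>\<rat>. a < b \<longrightarrow>
      \<not> ((\<exists>\<^sub>F n in sequentially. W n x < a) \<and> (\<exists>\<^sub>F n in sequentially. b \<le> W n x))"
    by (intro AE_ball_countable' countable_rat AE_impI cross)
  with AE_frequently_bounded[of M W, OF int bdd] show ?thesis
  proof eventually_elim
    case (elim x)
    then show ?case by (elim exE, intro convergent_if_no_crossings) auto
  qed
qed

section \<open>Deterministic weights and extrapolation\<close>

text \<open>The weights are \<open>c n = T n + T n * T (n + 1) + T n * T (n + 1) * T (n + 2) + \<dots>\<close>.\<close>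

lemma ex_momentum_weights:
  fixes T :: "nat \<Rightarrow> real"
  assumes "\<And>n. 0 \<le> T n" "\<And>n. T n \<le> C" "C < 1"
  obtains c \<kappa> where "\<And>n. 0 \<le> c n" "\<And>n. c n \<le> \<kappa>" "\<And>n. c n = T n * (1 + c (Suc n))"
proof -
  define f where "f = (\<lambda>n m. \<Prod>i\<le>m. T (n + i))"
  define c where "c = (\<lambda>n. \<Sum>m. f n m)"
  have C: "0 \<le> C" using assms(1,2)[of 0] by linarith
  have f0: "0 \<le> f n m" for n m by (simp add: f_def assms(1) prod_nonneg)
  have fC: "f n m \<le> C * C ^ m" for n m
  proof -
    have "f n m \<le> (\<Prod>i\<le>m. C)" unfolding f_def by (intro prod_mono) (use assms in auto)
    then show ?thesis by simp
  qed
  \<comment> \<open>The geometric majorant does not depend on \<open>n\<close>; its sum serves as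
    the uniform bound \<open>\<kappa>\<close>.\<close>
  have sC: "summable (\<lambda>m. C * C ^ m)" using C assms(3) by (intro summable_mult summable_geometric) simp
  have sf: "summable (f n)" for n
    by (rule summable_comparison_test'[OF sC, of 0]) (use f0 fC in auto)
  show ?thesis
  proof
    show "0 \<le> c n" for n unfolding c_def by (intro suminf_nonneg sf f0)
    show "c n \<le> (\<Sum>m. C * C ^ m)" for n unfolding c_def by (intro suminf_le fC sf sC)
    show "c n = T n * (1 + c (Suc n))" for n
    proof -
      have "f n (Suc m) = T n * f (Suc n) m" for m
        by (simp add: f_def prod.atMost_Suc_shift del: prod.atMost_Suc)
      then have "(\<Sum>m. f n (Suc m)) = T n * c (Suc n)"
        by (simp add: c_def suminf_mult sf)
      moreover have "f n 0 = T n" by (simp add: f_def)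
      ultimately show ?thesis
        using suminf_split_head[OF sf[of n]] by (simp add: c_def algebra_simps)
    qed
  qed
qed

text \<open>Once \<open>d n\<close> stays below \<open>(1 - q) * \<delta>\<close>, the level
  \<open>\<delta>\<close> reproduces itself, since
  \<open>q * \<delta> + (1 - q) * \<delta> = \<delta>\<close>; the initial contribution shrinks
  geometrically.\<close>

lemma contraction_with_null_error_tendsto_0:
  fixes y d :: "nat \<Rightarrow> real"
  assumes "\<And>n. y (Suc n) \<le> q * y n + d n" "d \<longlonglongrightarrow> 0" "0 \<le> q" "q < 1" "\<And>n. 0 \<le> y n"
  shows "y \<longlonglongrightarrow> 0"
proof (rule LIMSEQ_I)
  fix \<epsilon> :: real assume \<epsilon>: "0 < \<epsilon>"
  define \<delta> where "\<delta> = \<epsilon> / 2"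
  have \<delta>: "0 < \<delta>" using \<epsilon> by (simp add: \<delta>_def)
  have "\<forall>\<^sub>F n in sequentially. d n < (1 - q) * \<delta>"
    using assms(2,4) \<delta> by (intro order_tendstoD(2)[where y = 0]) auto
  then obtain N where N: "\<And>n. N \<le> n \<Longrightarrow> d n < (1 - q) * \<delta>"
    by (auto simp: eventually_sequentially)
  have bound: "y (N + k) \<le> q ^ k * y N + \<delta>" for k
  proof (induction k)
    case 0
    show ?case using \<delta> by simp
  next
    case (Suc k)
    have "y (N + Suc k) \<le> q * y (N + k) + d (N + k)" using assms(1) by simp
    also have "\<dots> \<le> q * (q ^ k * y N + \<delta>) + (1 - q) * \<delta>"
      using Suc N[of "N + k"] assms(3) by (intro add_mono mult_left_mono) auto
    finally show ?case by (simp add: algebra_simps)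
  qed
  have "(\<lambda>k. q ^ k * y N) \<longlonglongrightarrow> 0"
    using assms(3,4) by (intro tendsto_mult_left_zero LIMSEQ_power_zero) simp
  then have "\<forall>\<^sub>F k in sequentially. q ^ k * y N < \<delta>"
    using \<delta> by (intro order_tendstoD(2)[where y = 0]) auto
  then obtain K where K: "\<And>k. K \<le> k \<Longrightarrow> q ^ k * y N < \<delta>"
    by (auto simp: eventually_sequentially)
  show "\<exists>no. \<forall>n\<ge>no. norm (y n - 0) < \<epsilon>"
  proof (intro exI allI impI)
    fix n assume n: "N + K \<le> n"
    then have "y n \<le> q ^ (n - N) * y N + \<delta>" using bound[of "n - N"] by simp
    also have "\<dots> < \<delta> + \<delta>" using K[of "n - N"] n by linarith
    also have "\<dots> = \<epsilon>" by (simp add: \<delta>_def)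
    finally show "norm (y n - 0) < \<epsilon>" using assms(5) by simp
  qed
qed

text \<open>With weights \<open>1 / (1 + c n)\<close> and \<open>c n / (1 + c n)\<close>,
  \<open>x (Suc n)\<close> is a convex combination of a number at most \<open>L\<close> and of
  \<open>x n\<close>, so it cannot exceed the larger of the two.\<close>

lemma extrapolation_bounded:
  fixes x c :: "nat \<Rightarrow> real"
  assumes "\<And>n. (1 + c n) * x (Suc n) - c n * x n \<le> L" "\<And>n. 0 \<le> c n"
  shows "x n \<le> max L (x 0)"
proof (induction n)
  case 0
  show ?case by simp
next
  case (Suc n)
  let ?m = "max L (x 0)"
  have "(1 + c n) * x (Suc n) \<le> L + c n * x n" using assms(1)[of n] by simp
  also have "\<dots> \<le> ?m + c n * ?m"
    by (intro add_mono mult_left_mono Suc assms(2)) simp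
  also have "\<dots> = (1 + c n) * ?m" by (simp add: algebra_simps)
  finally show ?case using assms(2)[of n] by (simp add: mult_le_cancel_left)
qed

text \<open>Solving for \<open>x (Suc n) - w\<close> gives \<open>c n / (1 + c n)\<close> times the
  previous deviation plus a vanishing error. Boundedness of \<open>c\<close> keeps this factor at
  most \<open>\<kappa> / (1 + \<kappa>)\<close>, which is less than 1.\<close>

lemma extrapolation_tendsto:
  fixes x c :: "nat \<Rightarrow> real"
  assumes "(\<lambda>n. (1 + c n) * x (Suc n) - c n * x n) \<longlonglongrightarrow> w"
    and c: "\<And>n. 0 \<le> c n" "\<And>n. c n \<le> \<kappa>"
  shows "x \<longlonglongrightarrow> w"
proof -
  define d where "d = (\<lambda>n. \<bar>(1 + c n) * x (Suc n) - c n * x n - w\<bar>)"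
  define q where "q = \<kappa> / (1 + \<kappa>)"
  have \<kappa>: "0 \<le> \<kappa>" using c[of 0] by linarith
  have "(\<lambda>n. \<bar>x n - w\<bar>) \<longlonglongrightarrow> 0"
  proof (rule contraction_with_null_error_tendsto_0)
    show "\<bar>x (Suc n) - w\<bar> \<le> q * \<bar>x n - w\<bar> + d n" for n
    proof -
      have pos: "0 < 1 + c n" using c(1)[of n] by linarith
      let ?D = "(1 + c n) * x (Suc n) - c n * x n - w"
      have "x (Suc n) - w = c n / (1 + c n) * (x n - w) + ?D / (1 + c n)"
      proof -
        have "(1 + c n) * (x (Suc n) - w) = c n * (x n - w) + ?D" by (simp add: algebra_simps)
        then have "x (Suc n) - w = (c n * (x n - w) + ?D) / (1 + c n)"
          using pos by (simp add: nonzero_eq_divide_eq mult.commute)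
        then show ?thesis by (simp add: add_divide_distrib)
      qed
      also have "\<bar>\<dots>\<bar> \<le> \<bar>c n / (1 + c n) * (x n - w)\<bar> + \<bar>?D / (1 + c n)\<bar>"
        by (rule abs_triangle_ineq)
      also have "\<dots> = c n / (1 + c n) * \<bar>x n - w\<bar> + d n / (1 + c n)"
        using pos c(1)[of n] by (simp add: d_def abs_mult)
      also have "\<dots> \<le> q * \<bar>x n - w\<bar> + d n"
      proof (intro add_mono mult_right_mono)
        show "c n / (1 + c n) \<le> q"
          unfolding q_def using pos \<kappa> c(2)[of n] by (simp add: field_simps)
        have "d n * 1 \<le> d n * (1 + c n)"
          using c(1)[of n] by (intro mult_left_mono) (auto simp: d_def)
        then show "d n / (1 + c n) \<le> d n" using pos by (simp add: pos_divide_le_eq)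
      qed auto
      finally show ?thesis .
    qed
    show "d \<longlonglongrightarrow> 0"
      unfolding d_def using assms(1) by (simp add: LIM_zero tendsto_rabs_zero)
    show "0 \<le> q" "q < 1" using \<kappa> by (simp_all add: q_def)
  qed simp
  then show ?thesis
    by (simp add: tendsto_rabs_zero_iff LIM_zero_iff)
qed

section \<open>The inertial recursion for integrable sequences\<close>

text \<open>The second-order recursion becomes a first-order one for the weighted difference
  \<open>W\<close>. As \<open>W n\<close> involves \<open>R (Suc n)\<close>, the latter has to be
  measurable with respect to \<open>G n\<close>. The recursion is given in the form integrated over
  events of \<open>G n\<close>, the form in which Doob's argument uses it.\<close>

lemma inertial_almost_supermartingale:
  fixes R \<eta> err :: "nat \<Rightarrow> 'a \<Rightarrow> real" and T :: "nat \<Rightarrow> real"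
  assumes "prob_space M" "filtration (space M) G" "\<And>n. subalgebra M (G n)"
    and measR: "\<And>n. R n \<in> borel_measurable (G n)" "\<And>n. R (Suc n) \<in> borel_measurable (G n)"
    and int: "\<And>n. integrable M (R n)" "\<And>n. integrable M (\<eta> n)" "\<And>n. integrable M (err n)"
    and nonneg: "\<And>n. AE x in M. 0 \<le> R n x" "\<And>n. AE x in M. 0 \<le> \<eta> n x" "\<And>n. AE x in M. 0 \<le> err n x"
    and T: "\<And>n. 0 \<le> T n" "\<And>n. T n \<le> C" "C < 1"
    and err: "summable (\<lambda>n. \<integral>x. err n x \<partial>M)"
    and step: "\<And>n B. B \<in> sets (G n) \<Longrightarrow> (\<integral>x. indicator B x * R (Suc (Suc n)) x \<partial>M) \<le>
      (\<integral>x. indicator B x * ((1 + T n) * R (Suc n) x - T n * R n x - \<eta> n x + err n x) \<partial>M)"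
  shows "AE x in M. convergent (\<lambda>n. R n x)" "AE x in M. summable (\<lambda>n. \<eta> n x)"
proof -
  interpret prob_space M by fact
  obtain c \<kappa> where c: "\<And>n. 0 \<le> c n" "\<And>n. c n \<le> \<kappa>" "\<And>n. c n = T n * (1 + c (Suc n))"
    using ex_momentum_weights[of T C] T by metis
  have \<kappa>: "0 \<le> \<kappa>" using c(1,2)[of 0] by linarith
  have sub: "sets (G n) \<subseteq> sets M" for n
    using assms(3)[of n] by (simp add: subalgebra_def)
  have space_sets: "space M \<in> sets (G n)" for n
    using sets.top[of "G n"] filtration.space_F[OF assms(2)] by simp
  define W where "W = (\<lambda>n x. (1 + c n) * R (Suc n) x - c n * R n x)"
  define \<epsilon> where "\<epsilon> = (\<lambda>n. \<integral>x. err n x \<partial>M)"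
  define e where "e = (\<lambda>n. (1 + \<kappa>) * \<epsilon> n)"
  have \<epsilon>0: "0 \<le> \<epsilon> n" for n unfolding \<epsilon>_def by (rule integral_nonneg_AE[OF nonneg(3)])
  have e0: "0 \<le> e n" for n using \<epsilon>0 \<kappa> by (simp add: e_def)
  have es: "summable e" unfolding e_def using err by (intro summable_mult) (simp add: \<epsilon>_def)
  have Wint: "integrable M (W n)" for n unfolding W_def using int by auto
  have iB: "integrable M (\<lambda>x. indicator B x * f x)" if "B \<in> sets (G n)" "integrable M f"
    for B n and f :: "'a \<Rightarrow> real"
    using integrable_mult_indicator[of B M f] that sub by auto
  \<comment> \<open>The decrement is kept on the right: with \<open>B = space M\<close> it controls
    the sum of the expectations of \<open>\<eta>\<close>, and dropping it leaves the almost
    supermartingale inequality.\<close>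
  have key: "(\<integral>x. indicator B x * (W (Suc n) x - W n x) \<partial>M) \<le> e n - (\<integral>x. indicator B x * \<eta> n x \<partial>M)"
    if B: "B \<in> sets (G n)" for B n
  proof -
    note I = iB[OF B]
    let ?I = "\<lambda>f. \<integral>x. indicator B x * f x \<partial>M"
    have c1: "0 \<le> 1 + c (Suc n)" using c(1)[of "Suc n"] by simp
    have nn: "0 \<le> ?I (\<eta> n)" "0 \<le> ?I (err n)"
    proof -
      have "AE x in M. 0 \<le> indicator B x * \<eta> n x" "AE x in M. 0 \<le> indicator B x * err n x"
        using nonneg(2,3)[of n] by (eventually_elim, simp)+
      then show "0 \<le> ?I (\<eta> n)" "0 \<le> ?I (err n)" by (simp_all add: integral_nonneg_AE)
    qed
    have errB: "?I (err n) \<le> \<epsilon> n"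
      unfolding \<epsilon>_def using nonneg(3)[of n]
      by (intro integral_mono_AE I int) (auto elim!: eventually_mono simp: indicator_def)
    have rhs: "?I (\<lambda>x. (1 + T n) * R (Suc n) x - T n * R n x - \<eta> n x + err n x) =
        (1 + T n) * ?I (R (Suc n)) - T n * ?I (R n) - ?I (\<eta> n) + ?I (err n)"
    proof -
      have "?I (\<lambda>x. (1 + T n) * R (Suc n) x - T n * R n x - \<eta> n x + err n x) =
        (\<integral>x. (1 + T n) * (indicator B x * R (Suc n) x) - T n * (indicator B x * R n x)
           - indicator B x * \<eta> n x + indicator B x * err n x \<partial>M)"
        by (intro Bochner_Integration.integral_cong) (auto simp: algebra_simps)
      then show ?thesis using I int by simp
    qed
    have "?I (\<lambda>x. W (Suc n) x - W n x) =
        (\<integral>x. (1 + c (Suc n)) * (indicator B x * R (Suc (Suc n)) x)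
           - c (Suc n) * (indicator B x * R (Suc n) x)
           - (1 + c n) * (indicator B x * R (Suc n) x) + c n * (indicator B x * R n x) \<partial>M)"
      by (intro Bochner_Integration.integral_cong) (auto simp: W_def algebra_simps)
    also have "\<dots> = (1 + c (Suc n)) * ?I (R (Suc (Suc n)))
        - c (Suc n) * ?I (R (Suc n)) - (1 + c n) * ?I (R (Suc n)) + c n * ?I (R n)"
      using I int by simp
    also have "\<dots> \<le> (1 + c (Suc n)) * ((1 + T n) * ?I (R (Suc n)) - T n * ?I (R n) - ?I (\<eta> n) + ?I (err n))
        - c (Suc n) * ?I (R (Suc n)) - (1 + c n) * ?I (R (Suc n)) + c n * ?I (R n)"
      using mult_left_mono[OF step[OF B] c1] by (simp add: rhs)
    \<comment> \<open>By \<open>c n = T n * (1 + c (Suc n))\<close> the coefficients of the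
      integrals of \<open>R (Suc n)\<close> and of \<open>R n\<close> both cancel. This is the
      purpose of the weights.\<close>
    also have "\<dots> = (1 + c (Suc n)) * (?I (err n) - ?I (\<eta> n))"
      by (subst (1 2) c(3)[of n]) (simp add: algebra_simps)
    also have "\<dots> \<le> e n - ?I (\<eta> n)"
    proof -
      have "(1 + c (Suc n)) * ?I (err n) \<le> (1 + \<kappa>) * \<epsilon> n"
        using c(2)[of "Suc n"] \<kappa> errB nn by (intro mult_mono) auto
      moreover have "1 * ?I (\<eta> n) \<le> (1 + c (Suc n)) * ?I (\<eta> n)"
        using c(1)[of "Suc n"] nn by (intro mult_right_mono) auto
      ultimately show ?thesis by (simp add: e_def right_diff_distrib)
    qed
    finally show ?thesis .
  qed
  define x where "x = (\<lambda>n. \<integral>\<omega>. R n \<omega> \<partial>M)"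
  define y where "y = (\<lambda>n. \<integral>\<omega>. \<eta> n \<omega> \<partial>M)"
  have x0: "0 \<le> x n" for n unfolding x_def by (rule integral_nonneg_AE[OF nonneg(1)])
  have y0: "0 \<le> y n" for n unfolding y_def by (rule integral_nonneg_AE[OF nonneg(2)])
  have Wx: "(\<integral>\<omega>. W n \<omega> \<partial>M) = (1 + c n) * x (Suc n) - c n * x n" for n
    unfolding W_def x_def using int by simp
  define L where "L = (\<integral>\<omega>. W 0 \<omega> \<partial>M) + suminf e"
  have sumW: "(\<integral>\<omega>. W n \<omega> \<partial>M) + (\<Sum>i<n. y i) \<le> L" for n
  proof -
    have "(\<integral>\<omega>. W n \<omega> \<partial>M) + (\<Sum>i<n. y i) \<le> (\<integral>\<omega>. W 0 \<omega> \<partial>M) + (\<Sum>i<n. e i)"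
    proof (induction n)
      case (Suc n)
      have "(\<integral>\<omega>. indicator (space M) \<omega> * (W (Suc n) \<omega> - W n \<omega>) \<partial>M) = (\<integral>\<omega>. W (Suc n) \<omega> - W n \<omega> \<partial>M)"
        "(\<integral>\<omega>. indicator (space M) \<omega> * \<eta> n \<omega> \<partial>M) = (\<integral>\<omega>. \<eta> n \<omega> \<partial>M)"
        by (auto intro!: Bochner_Integration.integral_cong)
      then show ?case using Suc key[OF space_sets, of n] Wint by (simp add: y_def)
    qed simp
    also have "\<dots> \<le> L" using sum_le_suminf[OF es, of "{..<n}"] e0 by (simp add: L_def)
    finally show ?thesis .
  qed
  \<comment> \<open>Dropping the nonnegative \<open>y i\<close> from \<open>sumW\<close> shows that
    the expectations \<open>x\<close> obey the deterministic extrapolation inequality with bound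
    \<open>L\<close>. So the \<open>R n\<close> are bounded in L1, and with them the
    \<open>W n\<close>.\<close>
  define X where "X = max L (x 0)"
  have xX: "x n \<le> X" for n
    unfolding X_def
  proof (rule extrapolation_bounded[of c])
    show "(1 + c n) * x (Suc n) - c n * x n \<le> L" for n
      using sumW[of n] y0 sum_nonneg[of "{..<n}" y] by (simp add: Wx)
  qed (rule c)
  have W_abs: "(\<integral>\<omega>. \<bar>W n \<omega>\<bar> \<partial>M) \<le> (1 + \<kappa>) * X + \<kappa> * X" for n
  proof -
    have "(\<integral>\<omega>. \<bar>W n \<omega>\<bar> \<partial>M) \<le> (\<integral>\<omega>. (1 + c n) * R (Suc n) \<omega> + c n * R n \<omega> \<partial>M)"
    proof (rule integral_mono_AE)
      show "AE \<omega> in M. \<bar>W n \<omega>\<bar> \<le> (1 + c n) * R (Suc n) \<omega> + c n * R n \<omega>"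
        using nonneg(1)[of n] nonneg(1)[of "Suc n"]
      proof eventually_elim
        case (elim \<omega>)
        then have "0 \<le> (1 + c n) * R (Suc n) \<omega>" "0 \<le> c n * R n \<omega>" using c(1)[of n] by simp_all
        then show ?case unfolding W_def by linarith
      qed
    qed (use int Wint in auto)
    also have "\<dots> = (1 + c n) * x (Suc n) + c n * x n" using int by (simp add: x_def)
    also have "\<dots> \<le> (1 + \<kappa>) * X + \<kappa> * X"
      using c(1,2)[of n] \<kappa> xX x0 by (intro add_mono mult_mono) auto
    finally show ?thesis .
  qed
  have "AE \<omega> in M. convergent (\<lambda>n. W n \<omega>)"
  proof (rule almost_supermartingale_convergent[OF assms(1-3) _ Wint _ e0 es W_abs])
    show "W n \<in> borel_measurable (G n)" for n
      unfolding W_def using measR by measurable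
    show "(\<integral>x. indicator B x * (W (Suc n) x - W n x) \<partial>M) \<le> e n" if B: "B \<in> sets (G n)" for n B
    proof -
      have "0 \<le> (\<integral>x. indicator B x * \<eta> n x \<partial>M)"
        using nonneg(2)[of n] by (auto intro!: integral_nonneg_AE elim!: eventually_mono)
      then show ?thesis using key[OF B] by simp
    qed
  qed
  then show "AE \<omega> in M. convergent (\<lambda>n. R n \<omega>)"
  proof eventually_elim
    case (elim \<omega>)
    then obtain w where "(\<lambda>n. W n \<omega>) \<longlonglongrightarrow> w" by (auto simp: convergent_def)
    then have "(\<lambda>n. R n \<omega>) \<longlonglongrightarrow> w"
      unfolding W_def by (rule extrapolation_tendsto[OF _ c(1,2)])
    then show ?case by (auto simp: convergent_def)
  qed
  define S where "S = (\<lambda>n \<omega>. \<Sum>i<n. \<eta> i \<omega>)"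
  have Sint: "integrable M (S n)" for n unfolding S_def using int by auto
  have \<eta>0: "AE \<omega> in M. \<forall>n. 0 \<le> \<eta> n \<omega>" using nonneg(2) by (simp add: AE_all_countable)
  have "(\<integral>\<omega>. \<bar>S n \<omega>\<bar> \<partial>M) \<le> L + \<kappa> * X" for n
  proof -
    have "(\<integral>\<omega>. \<bar>S n \<omega>\<bar> \<partial>M) = (\<integral>\<omega>. S n \<omega> \<partial>M)"
      using \<eta>0 Sint by (intro integral_cong_AE) (auto elim!: eventually_mono simp: S_def sum_nonneg)
    also have "\<dots> = (\<Sum>i<n. y i)" unfolding S_def y_def using int by simp
    \<comment> \<open>The expectation of \<open>W n\<close> can be negative, but it is at least
      \<open>- c n * x n\<close>.\<close>
    also have "\<dots> \<le> L + c n * x n"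
    proof -
      have "0 \<le> (1 + c n) * x (Suc n)" using c(1)[of n] x0 by simp
      then show ?thesis using sumW[of n] unfolding Wx by linarith
    qed
    also have "\<dots> \<le> L + \<kappa> * X" using c(1,2)[of n] \<kappa> xX x0 by (intro add_left_mono mult_mono) auto
    finally show ?thesis .
  qed
  from AE_frequently_bounded[of M S, OF Sint this] \<eta>0 show "AE \<omega> in M. summable (\<lambda>n. \<eta> n \<omega>)"
  proof eventually_elim
    case (elim \<omega>)
    then obtain K where K: "\<exists>\<^sub>F n in sequentially. \<bar>S n \<omega>\<bar> \<le> K" by blast
    have "incseq (\<lambda>n. S n \<omega>)" unfolding S_def using elim(2) by (intro incseq_SucI) simp
    then have "S n \<omega> \<le> K" for n
      by (rule incseq_frequently_bounded) (use K in \<open>auto elim!: frequently_elim1\<close>)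
    then show ?case using elim(2) by (intro summableI_nonneg_bounded) (auto simp: S_def)
  qed
qed

section \<open>Localization of the conditional recursions\<close>

text \<open>This turns a recursion into an upper bound for the terms subtracted in it, which is how
  \<open>\<rho>\<close> and \<open>\<eta>\<close> are shown to be integrable on an event.\<close>

lemma pos_cond_exp_le_imp_nonneg:
  assumes "AE x in M. pos_cond_exp M G X x \<le> ereal (Y x)"
  shows "AE x in M. 0 \<le> Y x"
  using assms
proof eventually_elim
  case (elim x)
  have "0 \<le> pos_cond_exp M G X x" by (simp add: pos_cond_exp_def)
  also note elim
  finally show ?case by simp
qed

text \<open>Nonnegative integrals permit the comparison before \<open>X\<close> is known to be
  integrable on \<open>A\<close>, and the indicator of \<open>A\<close> passes through the
  conditional expectation since \<open>A\<close> belongs to \<open>G\<close>. Finiteness of the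
  right-hand side then makes real integrals available.\<close>

lemma localized_cond_exp_le:
  fixes X Y :: "'a \<Rightarrow> real"
  assumes "prob_space M" "subalgebra M G"
    and X: "X \<in> borel_measurable M" "AE x in M. 0 \<le> X x"
    and le: "AE x in M. pos_cond_exp M G X x \<le> ereal (Y x)"
    and A: "A \<in> sets G"
    and Y: "integrable M (\<lambda>x. indicator A x * Y x)"
  shows "integrable M (\<lambda>x. indicator A x * X x)"
    and "B \<in> sets G \<Longrightarrow> (\<integral>x. indicator B x * (indicator A x * X x) \<partial>M)
      \<le> (\<integral>x. indicator B x * (indicator A x * Y x) \<partial>M)"
proof -
  interpret prob_space M by fact
  interpret finite_measure_subalgebra M G by unfold_locales fact
  have sub: "sets G \<subseteq> sets M" using assms(2) by (simp add: subalgebra_def)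
  note [measurable] = X(1)
  have Y0: "AE x in M. 0 \<le> Y x" by (rule pos_cond_exp_le_imp_nonneg[OF le])
  have le': "AE x in M. nn_cond_exp M G (\<lambda>x. ennreal (X x)) x \<le> ennreal (Y x)"
    using le
  proof eventually_elim
    case (elim x)
    then have "e2ennreal (pos_cond_exp M G X x) \<le> e2ennreal (ereal (Y x))"
      by (rule e2ennreal_mono)
    then show ?case by (simp add: pos_cond_exp_def e2ennreal_ereal)
  qed
  have nn: "(\<integral>\<^sup>+x. ennreal (indicator B x * (indicator A x * X x)) \<partial>M)
      \<le> (\<integral>\<^sup>+x. ennreal (indicator B x * (indicator A x * Y x)) \<partial>M)" if B: "B \<in> sets G" for B
  proof -
    have BA: "B \<inter> A \<in> sets G" using A B by blast
    have ind: "ennreal (indicator B x * (indicator A x * f x)) = indicator (B \<inter> A) x * ennreal (f x)"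
      for f :: "'a \<Rightarrow> real" and x
      by (simp split: split_indicator)
    have "(\<integral>\<^sup>+x. indicator (B \<inter> A) x * ennreal (X x) \<partial>M) =
        (\<integral>\<^sup>+x. indicator (B \<inter> A) x * nn_cond_exp M G (\<lambda>x. ennreal (X x)) x \<partial>M)"
      using BA by (intro nn_cond_exp_intg[symmetric]) auto
    also have "\<dots> \<le> (\<integral>\<^sup>+x. indicator (B \<inter> A) x * ennreal (Y x) \<partial>M)"
      using le' by (intro nn_integral_mono_AE) (auto elim!: eventually_mono intro: mult_left_mono)
    finally show ?thesis by (simp only: ind)
  qed
  have ind_nonneg: "AE x in M. 0 \<le> indicator B x * (indicator A x * f x)"
    if "AE x in M. 0 \<le> f x" for f :: "'a \<Rightarrow> real" and B
    using that by eventually_elim simp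
  have int_ind: "integrable M (\<lambda>x. indicator B x * (indicator A x * f x))"
    if "B \<in> sets G" "integrable M (\<lambda>x. indicator A x * f x)" for f :: "'a \<Rightarrow> real" and B
    using integrable_mult_indicator[of B M "\<lambda>x. indicator A x * f x"] that sub by auto
  have eq_Y: "(\<integral>\<^sup>+x. ennreal (indicator B x * (indicator A x * Y x)) \<partial>M)
      = ennreal (\<integral>x. indicator B x * (indicator A x * Y x) \<partial>M)" if "B \<in> sets G" for B
    by (rule nn_integral_eq_integral[OF int_ind[OF that Y] ind_nonneg[OF Y0]])
  have Am [measurable]: "A \<in> sets M" using A sub by blast
  show int_X: "integrable M (\<lambda>x. indicator A x * X x)"
  proof (rule integrableI_nonneg)
    show "AE x in M. 0 \<le> indicator A x * X x" using X(2) by eventually_elim simp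
    \<comment> \<open>The comparison \<open>nn\<close> is applied with \<open>B = A\<close>, which
      the idempotence of the indicator allows.\<close>
    have "ennreal (indicator A x * f x) = ennreal (indicator A x * (indicator A x * f x))" for x f
      by (simp add: indicator_def)
    then have "(\<integral>\<^sup>+x. ennreal (indicator A x * X x) \<partial>M)
        = (\<integral>\<^sup>+x. ennreal (indicator A x * (indicator A x * X x)) \<partial>M)" by simp
    also have "\<dots> < \<infinity>" using nn[OF A] eq_Y[OF A] by (simp add: le_less_trans)
    finally show "(\<integral>\<^sup>+x. ennreal (indicator A x * X x) \<partial>M) < \<infinity>" .
  qed measurable
  show "(\<integral>x. indicator B x * (indicator A x * X x) \<partial>M)
      \<le> (\<integral>x. indicator B x * (indicator A x * Y x) \<partial>M)" if B: "B \<in> sets G"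
  proof -
    have "ennreal (\<integral>x. indicator B x * (indicator A x * X x) \<partial>M)
        \<le> ennreal (\<integral>x. indicator B x * (indicator A x * Y x) \<partial>M)"
      using nn[OF B] eq_Y[OF B] nn_integral_eq_integral[OF int_ind[OF B int_X] ind_nonneg[OF X(2)]]
      by simp
    then show ?thesis
      using integral_nonneg_AE[OF ind_nonneg[OF Y0, of B]] by (simp add: ennreal_le_iff)
  qed
qed

text \<open>The potential is the expectation of \<open>z n + a n * \<rho> n\<close> over
  \<open>A\<close>. As \<open>a\<close> decreases and \<open>\<rho>\<close> is nonnegative, each
  step changes it by at most \<open>b n\<close> minus \<open>p n\<close> times the expectation of
  \<open>z n\<close> over \<open>A\<close>. It stays nonnegative, so telescoping bounds the sum of
  these decrements.\<close>

lemma potential_summable: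
  fixes z \<rho> :: "nat \<Rightarrow> 'a \<Rightarrow> real" and p a b :: "nat \<Rightarrow> real"
  assumes "prob_space M" "\<And>n. subalgebra M (G n)" "\<And>n. A \<in> sets (G n)"
    and meas: "\<And>n. z n \<in> borel_measurable M" "\<And>n. \<rho> n \<in> borel_measurable M"
    and nonneg: "\<And>n. AE x in M. 0 \<le> z n x" "\<And>n. AE x in M. 0 \<le> \<rho> n x"
    and p: "\<And>n. 0 \<le> p n" and a: "\<And>n. 0 < a n" "\<And>n. a (Suc n) \<le> a n"
    and b: "\<And>n. 0 \<le> b n" "summable b"
    and step: "\<And>n. AE x in M. pos_cond_exp M (G n) (z (Suc n)) x
      \<le> ereal ((1 - p n) * z n x - a n * (\<rho> (Suc n) x - \<rho> n x) + b n)"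
    and int0: "integrable M (\<lambda>x. indicator A x * z 0 x)" "integrable M (\<lambda>x. indicator A x * \<rho> 0 x)"
  shows "integrable M (\<lambda>x. indicator A x * z n x)"
    and "summable (\<lambda>n. p n * (\<integral>x. indicator A x * z n x \<partial>M))"
proof -
  interpret prob_space M by fact
  have Am [measurable]: "A \<in> sets M" using assms(2,3)[of 0] by (auto simp: subalgebra_def)
  note [measurable] = meas
  define Z where "Z = (\<lambda>n x. indicator A x * z n x)"
  define Q where "Q = (\<lambda>n x. indicator A x * \<rho> n x)"
  define Y where "Y = (\<lambda>n x. (1 - p n) * z n x - a n * (\<rho> (Suc n) x - \<rho> n x) + b n)"
  have Y_eq: "(\<lambda>x. indicator A x * Y n x)
      = (\<lambda>x. (1 - p n) * Z n x - a n * (Q (Suc n) x - Q n x) + b n * indicator A x)" for n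
    by (auto simp: Y_def Z_def Q_def algebra_simps)
  have stepY: "AE x in M. pos_cond_exp M (G n) (z (Suc n)) x \<le> ereal (Y n x)" for n
    using step by (simp add: Y_def)
  note local = localized_cond_exp_le[OF assms(1,2) meas(1) nonneg(1) stepY assms(3)]
  have intA: "integrable M (indicator A :: 'a \<Rightarrow> real)"
    by (intro integrable_real_indicator Am) (simp add: less_top[symmetric])
  have Z0: "AE x in M. 0 \<le> Z n x" for n using nonneg(1)[of n] by eventually_elim (simp add: Z_def)
  have Q0: "AE x in M. 0 \<le> Q n x" for n using nonneg(2)[of n] by eventually_elim (simp add: Q_def)
  \<comment> \<open>Integrability of \<open>\<rho> (Suc n)\<close> on \<open>A\<close> has to come
    before that of \<open>z (Suc n)\<close>, whose upper bound contains it. Nonnegativity of that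
    bound gives \<open>a n * \<rho> (Suc n) \<le> z n + a n * \<rho> n + b n\<close>, and division
    by \<open>a n\<close> yields an integrable majorant.\<close>
  have QSuc: "integrable M (Q (Suc n))" if "integrable M (Z n)" "integrable M (Q n)" for n
  proof (rule Bochner_Integration.integrable_bound)
    show "integrable M (\<lambda>x. (Z n x + a n * Q n x + b n * indicator A x) / a n)"
      using that intA by auto
    show "Q (Suc n) \<in> borel_measurable M" unfolding Q_def by measurable
    show "AE x in M. norm (Q (Suc n) x) \<le> norm ((Z n x + a n * Q n x + b n * indicator A x) / a n)"
      using nonneg(1)[of n] nonneg(2)[of "Suc n"] pos_cond_exp_le_imp_nonneg[OF stepY[of n]]
    proof eventually_elim
      case (elim x)
      have "0 \<le> p n * z n x" using elim p by simp
      then have "a n * \<rho> (Suc n) x \<le> z n x + a n * \<rho> n x + b n"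
        using elim(3) by (simp add: Y_def algebra_simps)
      then have "\<rho> (Suc n) x \<le> (z n x + a n * \<rho> n x + b n) / a n"
        using a(1)[of n] by (simp add: pos_le_divide_eq mult.commute)
      also have "\<dots> \<le> \<bar>(z n x + a n * \<rho> n x + b n) / a n\<bar>" by (rule abs_ge_self)
      finally show ?case using elim(2) by (simp add: Q_def Z_def indicator_def)
    qed
  qed
  have int: "integrable M (Z n) \<and> integrable M (Q n)" for n
  proof (induction n)
    case 0
    show ?case using int0 by (simp add: Z_def Q_def)
  next
    case (Suc n)
    then have "integrable M (\<lambda>x. indicator A x * Y n x)"
      unfolding Y_eq using intA QSuc by auto
    then show ?case using local(1)[of n] Suc QSuc by (simp add: Z_def)
  qed
  then show "integrable M (\<lambda>x. indicator A x * z n x)" by (simp add: Z_def)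
  have Yint: "integrable M (\<lambda>x. indicator A x * Y n x)" for n
    unfolding Y_eq using int intA by auto
  define v where "v = (\<lambda>n. (\<integral>x. Z n x \<partial>M) + a n * (\<integral>x. Q n x \<partial>M))"
  define s where "s = (\<lambda>n. p n * (\<integral>x. Z n x \<partial>M))"
  have s0: "0 \<le> s n" for n unfolding s_def using p integral_nonneg_AE[OF Z0] by simp
  have descent: "v (Suc n) \<le> v n - s n + b n" for n
  proof -
    have "space M \<in> sets (G n)"
      using assms(2)[of n] by (metis sets.top subalgebra_def)
    moreover have "(\<integral>x. indicator (space M) x * f x \<partial>M) = (\<integral>x. f x \<partial>M)" for f :: "'a \<Rightarrow> real"
      by (auto intro!: Bochner_Integration.integral_cong)
    ultimately have "(\<integral>x. Z (Suc n) x \<partial>M) \<le> (\<integral>x. indicator A x * Y n x \<partial>M)"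
      using local(2)[OF Yint, of "space M" n] by (simp add: Z_def)
    also have "\<dots> = (1 - p n) * (\<integral>x. Z n x \<partial>M)
        - a n * ((\<integral>x. Q (Suc n) x \<partial>M) - (\<integral>x. Q n x \<partial>M)) + b n * prob A"
      unfolding Y_eq using int intA by simp
    finally have "(\<integral>x. Z (Suc n) x \<partial>M) \<le> (1 - p n) * (\<integral>x. Z n x \<partial>M)
        - a n * ((\<integral>x. Q (Suc n) x \<partial>M) - (\<integral>x. Q n x \<partial>M)) + b n * prob A" .
    moreover have "b n * prob A \<le> b n" using b(1)[of n] by (simp add: mult_left_le)
    moreover have "a (Suc n) * (\<integral>x. Q (Suc n) x \<partial>M) \<le> a n * (\<integral>x. Q (Suc n) x \<partial>M)"
      by (intro mult_right_mono a(2) integral_nonneg_AE[OF Q0])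
    ultimately show ?thesis by (simp add: v_def s_def algebra_simps)
  qed
  have "(\<Sum>i<n. s i) \<le> v 0 + suminf b" for n
  proof -
    have "v n + (\<Sum>i<n. s i) \<le> v 0 + (\<Sum>i<n. b i)"
    proof (induction n)
      case (Suc n)
      then show ?case using descent[of n] by simp
    qed simp
    moreover have "(\<Sum>i<n. b i) \<le> suminf b" using sum_le_suminf[OF b(2), of "{..<n}"] b(1) by auto
    moreover have "0 \<le> v n"
      unfolding v_def using a(1)[of n] integral_nonneg_AE[OF Z0] integral_nonneg_AE[OF Q0] by simp
    ultimately show ?thesis by simp
  qed
  then have "summable s" by (intro summableI_nonneg_bounded s0)
  then show "summable (\<lambda>n. p n * (\<integral>x. indicator A x * z n x \<partial>M))" by (simp add: s_def Z_def)
qed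

text \<open>Multiplying by the indicator of an event that lies in every \<open>G n\<close> preserves
  the form of the recursion. Integrability of two consecutive values on \<open>A\<close> propagates
  along it, and the integrable case applies to the sequences set to 0 outside
  \<open>A\<close>.\<close>

lemma localized_inertial_convergence:
  fixes r \<eta> err :: "nat \<Rightarrow> 'a \<Rightarrow> real" and \<theta> :: "nat \<Rightarrow> real"
  assumes "prob_space M" "filtration (space M) G" "\<And>n. subalgebra M (G n)" and A: "\<And>n. A \<in> sets (G n)"
    and meas: "\<And>n. r n \<in> borel_measurable (G n)" "\<And>n. r (Suc n) \<in> borel_measurable (G n)"
      "\<And>n. \<eta> n \<in> borel_measurable M"
    and nonneg: "\<And>n. AE x in M. 0 \<le> r n x" "\<And>n. AE x in M. 0 \<le> \<eta> n x" "\<And>n. AE x in M. 0 \<le> err n x"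
    and \<theta>: "\<And>n. 0 \<le> \<theta> n" "\<And>n. \<theta> n \<le> C" "C < 1"
    and err: "\<And>n. integrable M (\<lambda>x. indicator A x * err n x)"
      "summable (\<lambda>n. \<integral>x. indicator A x * err n x \<partial>M)"
    and step: "\<And>n. AE x in M. pos_cond_exp M (G n) (r (Suc (Suc n))) x
      \<le> ereal ((1 + \<theta> n) * r (Suc n) x - \<theta> n * r n x - \<eta> n x + err n x)"
    and int0: "integrable M (\<lambda>x. indicator A x * r 0 x)" "integrable M (\<lambda>x. indicator A x * r 1 x)"
  shows "AE x in M. x \<in> A \<longrightarrow> convergent (\<lambda>n. r n x) \<and> summable (\<lambda>n. \<eta> n x)"
proof -
  have Am [measurable]: "A \<in> sets M" using assms(3,4)[of 0] by (auto simp: subalgebra_def)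
  have measM [measurable]: "r n \<in> borel_measurable M" for n
    by (rule measurable_from_subalg[OF assms(3) meas(1)])
  note [measurable] = meas(3)
  define R where "R = (\<lambda>n x. indicator A x * r n x)"
  define E where "E = (\<lambda>n x. indicator A x * \<eta> n x)"
  define D where "D = (\<lambda>n x. indicator A x * err n x)"
  define Y where "Y = (\<lambda>n x. (1 + \<theta> n) * r (Suc n) x - \<theta> n * r n x - \<eta> n x + err n x)"
  have Y_eq: "indicator A x * Y n x = (1 + \<theta> n) * R (Suc n) x - \<theta> n * R n x - E n x + D n x" for n x
    by (auto simp: Y_def R_def E_def D_def algebra_simps)
  have stepY: "AE x in M. pos_cond_exp M (G n) (r (Suc (Suc n))) x \<le> ereal (Y n x)" for n
    using step by (simp add: Y_def)
  note local = localized_cond_exp_le[OF assms(1,3) measM nonneg(1) stepY A]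
  have Dint: "integrable M (D n)" for n using err(1) by (simp add: D_def)
  have R0: "AE x in M. 0 \<le> R n x" for n using nonneg(1)[of n] by eventually_elim (simp add: R_def)
  have E0: "AE x in M. 0 \<le> E n x" for n using nonneg(2)[of n] by eventually_elim (simp add: E_def)
  have D0: "AE x in M. 0 \<le> D n x" for n using nonneg(3)[of n] by eventually_elim (simp add: D_def)
  \<comment> \<open>The localized right-hand side is nonnegative and so is
    \<open>\<theta> n * R n x\<close>, which leaves \<open>E n x\<close> below
    \<open>(1 + \<theta> n) * R (Suc n) x + D n x\<close>.\<close>
  have Eint: "integrable M (E n)" if "integrable M (R (Suc n))" for n
  proof (rule Bochner_Integration.integrable_bound)
    show "integrable M (\<lambda>x. (1 + \<theta> n) * R (Suc n) x + D n x)" using that Dint by auto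
    show "E n \<in> borel_measurable M" unfolding E_def by measurable
    show "AE x in M. norm (E n x) \<le> norm ((1 + \<theta> n) * R (Suc n) x + D n x)"
      using R0[of n] E0[of n] pos_cond_exp_le_imp_nonneg[OF stepY[of n]]
    proof eventually_elim
      case (elim x)
      have "0 \<le> indicator A x * Y n x" "0 \<le> \<theta> n * R n x" using elim \<theta>(1) by simp_all
      then show ?case unfolding Y_eq using elim(2) by simp
    qed
  qed
  have Rint: "integrable M (R n) \<and> integrable M (R (Suc n))" for n
  proof (induction n)
    case 0
    show ?case using int0 by (simp add: R_def)
  next
    case (Suc n)
    then have "integrable M (\<lambda>x. indicator A x * Y n x)"
      unfolding Y_eq using Eint Dint by auto
    then show ?case using local(1)[of n] Suc by (simp add: R_def)
  qed
  have Yint: "integrable M (\<lambda>x. indicator A x * Y n x)" for n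
    unfolding Y_eq using Rint Eint Dint by auto
  have *: "AE x in M. convergent (\<lambda>n. R n x)" "AE x in M. summable (\<lambda>n. E n x)"
  proof -
    note [measurable] = meas(1,2) A
    have "R n \<in> borel_measurable (G n)" "R (Suc n) \<in> borel_measurable (G n)" for n
      unfolding R_def by measurable
    note lem = inertial_almost_supermartingale[OF assms(1-3) this _ _ Dint R0 E0 D0 \<theta>]
    have "summable (\<lambda>n. \<integral>x. D n x \<partial>M)" using err(2) by (simp add: D_def)
    note lem = lem[OF _ _ this]
    have "(\<integral>x. indicator B x * R (Suc (Suc n)) x \<partial>M) \<le>
      (\<integral>x. indicator B x * ((1 + \<theta> n) * R (Suc n) x - \<theta> n * R n x - E n x + D n x) \<partial>M)"
      if "B \<in> sets (G n)" for n B
      using local(2)[OF Yint that] unfolding Y_eq by (simp add: R_def)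
    note lem = lem[OF _ _ this]
    show "AE x in M. convergent (\<lambda>n. R n x)" "AE x in M. summable (\<lambda>n. E n x)"
      by (rule lem; use Rint Eint in auto)+
  qed
  then show ?thesis
    by eventually_elim (auto simp: R_def E_def)
qed

section \<open>Shifting the indices and exhausting the space\<close>

theorem lemma22:
  fixes M :: "'a measure"
    and F :: "nat \<Rightarrow> 'a measure"
    and r \<eta> z \<rho> :: "nat \<Rightarrow> 'a \<Rightarrow> real"
    and \<theta> a p \<beta> \<beta>bar :: "nat \<Rightarrow> real"
    and h :: real
  assumes "prob_space M"
    and "filtration (space M) F"
    and "\<And>k. subalgebra M (F k)"
    and "\<And>k. k \<ge> 1 \<Longrightarrow> r k \<in> borel_measurable (F k)"
    and "\<And>k. k \<ge> 1 \<Longrightarrow> \<eta> k \<in> borel_measurable (F k)"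
    and "\<And>k. k \<ge> 1 \<Longrightarrow> z k \<in> borel_measurable (F k)"
    and "\<And>k. \<rho> k \<in> borel_measurable (F k)"
    and "\<And>k. k \<ge> 1 \<Longrightarrow> AE \<omega> in M. r k \<omega> > 0"
    and "\<And>k. k \<ge> 1 \<Longrightarrow> AE \<omega> in M. \<eta> k \<omega> > 0"
    and "\<And>k. k \<ge> 1 \<Longrightarrow> AE \<omega> in M. z k \<omega> > 0"
    and "\<And>k. AE \<omega> in M. \<rho> k \<omega> > 0"
    and "\<And>k. k \<ge> 1 \<Longrightarrow> \<theta> k \<in> {0<..<1}"
    and "\<exists>c<1. \<forall>k\<ge>1. \<theta> k \<le> c"
    and "\<And>k. k \<ge> 1 \<Longrightarrow> a k > 0"
    and "\<And>k. k \<ge> 1 \<Longrightarrow> a (k + 1) \<le> a k"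
    and "h > 0"
    and "\<And>k. k \<ge> 1 \<Longrightarrow> p k \<ge> 0"
    and "\<And>k. k \<ge> 1 \<Longrightarrow> \<beta> k \<ge> 0"
    and "\<And>k. k \<ge> 1 \<Longrightarrow> \<beta>bar k \<ge> 0"
    and "summable (\<lambda>k. \<beta> (k + 1))"
    and "summable (\<lambda>k. \<beta>bar (k + 1))"
    and "\<And>k. k \<ge> 1 \<Longrightarrow> AE \<omega> in M. pos_cond_exp M (F (k + 1)) (r (k + 2)) \<omega>
           \<le> ereal ((1 + \<theta> k) * r (k + 1) \<omega> - \<theta> k * r k \<omega> - \<eta> k \<omega> + \<beta> k
                    + h * p k * z (k + 1) \<omega>)"
    and "\<And>k. k \<ge> 1 \<Longrightarrow> AE \<omega> in M. pos_cond_exp M (F (k + 1)) (z (k + 2)) \<omega>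
           \<le> ereal ((1 - p k) * z (k + 1) \<omega> - a k * (\<rho> k \<omega> - \<rho> (k - 1) \<omega>) + \<beta>bar k)"
  shows "(\<exists>r_inf :: 'a \<Rightarrow> real. r_inf \<in> borel_measurable M
            \<and> (AE \<omega> in M. (\<lambda>k. r k \<omega>) \<longlonglongrightarrow> r_inf \<omega>))
         \<and> (AE \<omega> in M. summable (\<lambda>k. \<eta> (k + 1) \<omega>))"
proof -
  interpret prob_space M by fact
  \<comment> \<open>Index \<open>n\<close> of the shifted recursions stands for
    \<open>k = n + 1\<close>, so the conditioning is on
    \<open>F (k + 1) = F (n + 2)\<close>.\<close>
  define G where "G = (\<lambda>n. F (n + 2))"
  have G_filt: "filtration (space M) G"
    using assms(2) by (simp add: G_def filtration_def)
  have F_le: "sets (F m) \<subseteq> sets (F n)" if "m \<le> n" for m n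
    by (rule filtration.sets_F_mono[OF assms(2) that])
  have F_meas: "f \<in> borel_measurable (F n)"
    if "f \<in> borel_measurable (F m)" "m \<le> n" for f :: "'a \<Rightarrow> real" and m n
    by (rule measurable_from_subalg[OF _ that(1)])
      (use F_le[OF that(2)] filtration.space_F[OF assms(2)] in \<open>simp add: subalgebra_def\<close>)
  have M_meas: "f \<in> borel_measurable M" if "f \<in> borel_measurable (F n)" for f :: "'a \<Rightarrow> real" and n
    by (rule measurable_from_subalg[OF assms(3) that])
  \<comment> \<open>A uniform bound below 1 is what makes the geometric majorant of the weights
    summable.\<close>
  obtain C where C: "C < 1" "\<And>k. 1 \<le> k \<Longrightarrow> \<theta> k \<le> C" using assms(13) by blast
  have r_meas [measurable]: "r (Suc n) \<in> borel_measurable M" for n by (rule M_meas, rule assms(4)) simp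
  have eta_meas [measurable]: "\<eta> (Suc n) \<in> borel_measurable M" for n by (rule M_meas, rule assms(5)) simp
  have z_meas [measurable]: "z (Suc n) \<in> borel_measurable M" for n by (rule M_meas, rule assms(6)) simp
  have rho_meas [measurable]: "\<rho> n \<in> borel_measurable M" for n by (rule M_meas, rule assms(7))
  have r0: "AE x in M. 0 \<le> r (Suc n) x" for n using assms(8)[of "Suc n"] by (auto elim!: eventually_mono)
  have eta0: "AE x in M. 0 \<le> \<eta> (Suc n) x" for n using assms(9)[of "Suc n"] by (auto elim!: eventually_mono)
  have z0: "AE x in M. 0 \<le> z (Suc n) x" for n using assms(10)[of "Suc n"] by (auto elim!: eventually_mono)
  have rho0: "AE x in M. 0 \<le> \<rho> n x" for n using assms(11)[of n] by (auto elim!: eventually_mono)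
  \<comment> \<open>These four initial values start the integrability inductions. They are all
    measurable with respect to \<open>F 2 = G 0\<close>, so \<open>A N\<close> lies in every
    \<open>G n\<close>.\<close>
  define A where "A = (\<lambda>N::nat. {x \<in> space M. r 1 x \<le> N \<and> r 2 x \<le> N \<and> z 2 x \<le> N \<and> \<rho> 0 x \<le> N})"
  have A_sets: "A N \<in> sets (G n)" for N n
  proof -
    have [measurable]: "r 1 \<in> borel_measurable (G n)" "r 2 \<in> borel_measurable (G n)"
      "z 2 \<in> borel_measurable (G n)" "\<rho> 0 \<in> borel_measurable (G n)"
      unfolding G_def by (auto intro: F_meas[OF assms(4)] F_meas[OF assms(6)] F_meas[OF assms(7)])
    have "{x \<in> space (G n). r 1 x \<le> N \<and> r 2 x \<le> N \<and> z 2 x \<le> N \<and> \<rho> 0 x \<le> N} \<in> sets (G n)"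
      by measurable
    then show ?thesis using filtration.space_F[OF G_filt] by (simp add: A_def)
  qed
  have A_M [measurable]: "A N \<in> sets M" for N
    using A_sets[of N 0] assms(3)[of "0 + 2"] unfolding G_def subalgebra_def by blast
  have int_A: "integrable M (\<lambda>x. indicator (A N) x * f x)"
    if [measurable]: "f \<in> borel_measurable M" and f: "AE x in M. 0 \<le> f x"
      and "\<And>x. x \<in> A N \<Longrightarrow> f x \<le> real N" for f :: "'a \<Rightarrow> real" and N
  proof (rule integrable_const_bound)
    show "AE x in M. norm (indicator (A N) x * f x) \<le> real N"
      using f by eventually_elim (use that(3) in \<open>auto simp: indicator_def\<close>)
  qed measurable
  have A_conv: "AE x in M. x \<in> A N \<longrightarrow> convergent (\<lambda>n. r (Suc n) x) \<and> summable (\<lambda>n. \<eta> (Suc n) x)" for N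
  proof -
    have z_step: "AE x in M. pos_cond_exp M (G n) (z (Suc (Suc (Suc n)))) x
      \<le> ereal ((1 - p (Suc n)) * z (Suc (Suc n)) x - a (Suc n) * (\<rho> (Suc n) x - \<rho> n x) + \<beta>bar (Suc n))" for n
      using assms(23)[of "Suc n"] by (simp add: G_def numeral_2_eq_2)
    have init: "integrable M (\<lambda>x. indicator (A N) x * z (Suc (Suc 0)) x)"
      "integrable M (\<lambda>x. indicator (A N) x * \<rho> 0 x)"
      "integrable M (\<lambda>x. indicator (A N) x * r (Suc 0) x)"
      "integrable M (\<lambda>x. indicator (A N) x * r (Suc (Suc 0)) x)"
      by (rule int_A[OF z_meas z0] int_A[OF rho_meas rho0] int_A[OF r_meas r0];
          simp add: A_def numeral_2_eq_2)+
    note potential = potential_summable[of M G "A N" "\<lambda>n. z (Suc (Suc n))" \<rho> "\<lambda>n. p (Suc n)" "\<lambda>n. a (Suc n)"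
        "\<lambda>n. \<beta>bar (Suc n)", OF assms(1) _ A_sets z_meas rho_meas z0 rho0 _ _ _ _ _ z_step]
    have pot: "integrable M (\<lambda>x. indicator (A N) x * z (Suc (Suc n)) x)"
      "summable (\<lambda>n. p (Suc n) * (\<integral>x. indicator (A N) x * z (Suc (Suc n)) x \<partial>M))" for n
      by (rule potential; use assms(3,14,15,17,19,21) init in \<open>simp add: G_def\<close>)+
    \<comment> \<open>The coupling term is absorbed into the error; its expectations over
      \<open>A N\<close> are summable by \<open>pot\<close>.\<close>
    define err where "err = (\<lambda>n x. \<beta> (Suc n) + h * p (Suc n) * z (Suc (Suc n)) x)"
    have err_eq: "(\<lambda>x. indicator (A N) x * err n x) =
        (\<lambda>x. \<beta> (Suc n) * indicator (A N) x + h * p (Suc n) * (indicator (A N) x * z (Suc (Suc n)) x))" for n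
      by (auto simp: err_def algebra_simps)
    have intA: "integrable M (indicator (A N) :: 'a \<Rightarrow> real)"
      by (intro integrable_real_indicator A_M) (simp add: less_top[symmetric])
    have err_int: "integrable M (\<lambda>x. indicator (A N) x * err n x)" for n
      unfolding err_eq using intA pot(1) by auto
    have err_integral: "(\<integral>x. indicator (A N) x * err n x \<partial>M) = prob (A N) * \<beta> (Suc n)
        + h * (p (Suc n) * (\<integral>x. indicator (A N) x * z (Suc (Suc n)) x \<partial>M))" for n
      unfolding err_eq using intA pot(1) by simp
    have err_sum: "summable (\<lambda>n. \<integral>x. indicator (A N) x * err n x \<partial>M)"
      unfolding err_integral using assms(20) pot(2) by (intro summable_add summable_mult) auto
    have err0: "AE x in M. 0 \<le> err n x" for n
      using z0[of "Suc n"] by eventually_elim (use assms(16-18) in \<open>simp add: err_def\<close>)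
    have r_step: "AE x in M. pos_cond_exp M (G n) (r (Suc (Suc (Suc n)))) x
      \<le> ereal ((1 + \<theta> (Suc n)) * r (Suc (Suc n)) x - \<theta> (Suc n) * r (Suc n) x - \<eta> (Suc n) x + err n x)" for n
      using assms(22)[of "Suc n"] by (simp add: G_def numeral_2_eq_2 err_def add.assoc)
    have r_G: "r (Suc n) \<in> borel_measurable (G n)" "r (Suc (Suc n)) \<in> borel_measurable (G n)" for n
      unfolding G_def by (auto intro: F_meas[OF assms(4)])
    show ?thesis
      by (rule localized_inertial_convergence[of M G "A N" "\<lambda>n. r (Suc n)" "\<lambda>n. \<eta> (Suc n)" err
            "\<lambda>n. \<theta> (Suc n)" C, OF assms(1) G_filt _ A_sets r_G eta_meas r0 eta0 err0 _ _ C(1) err_int err_sum r_step])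
        (use assms(3,12) C(2) init in \<open>simp_all add: G_def less_imp_le\<close>)
  qed
  have conv: "AE x in M. convergent (\<lambda>n. r (Suc n) x) \<and> summable (\<lambda>n. \<eta> (Suc n) x)"
  proof -
    have "AE x in M. \<forall>N. x \<in> A N \<longrightarrow> convergent (\<lambda>n. r (Suc n) x) \<and> summable (\<lambda>n. \<eta> (Suc n) x)"
      unfolding AE_all_countable using A_conv by (rule allI)
    with AE_space show ?thesis
    proof eventually_elim
      case (elim x)
      obtain N where "max (max (r 1 x) (r 2 x)) (max (z 2 x) (\<rho> 0 x)) \<le> real N"
        using real_arch_simple by blast
      then have "x \<in> A N" using elim(1) by (simp add: A_def)
      then show ?case using elim(2) by blast
    qed
  qed
  show ?thesis
  proof (intro conjI exI)
    \<comment> \<open>\<open>lim\<close> is a total function, and its measurability extends over the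
      null set where the sequence may diverge. The sequence starts at \<open>r 1\<close> because
      measurability is given from index 1 on.\<close>
    show "(\<lambda>x. lim (\<lambda>n. r (Suc n) x)) \<in> borel_measurable M"
      by (rule borel_measurable_lim_metric) (rule r_meas)
    show "AE x in M. (\<lambda>k. r k x) \<longlonglongrightarrow> lim (\<lambda>n. r (Suc n) x)"
      using conv
    proof eventually_elim
      case (elim x)
      then have "(\<lambda>n. r (Suc n) x) \<longlonglongrightarrow> lim (\<lambda>n. r (Suc n) x)"
        by (simp add: convergent_LIMSEQ_iff)
      then show ?case by (rule LIMSEQ_imp_Suc)
    qed
    show "AE x in M. summable (\<lambda>k. \<eta> (k + 1) x)"
      using conv by eventually_elim simp
  qed
qed

end
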